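(* Let $G$ be a connected infinite graph with vertex set $V$ and finite maximum degree $d$. For $x_0\in V$ let $(X_n)_{n\ge 0}$ be simple random walk on $G$ with $X_0=x_0$, and let $$E_n(x_0) = -\sum_{x\in V}\mathbf{P}(X_n=x)\log\big(\mathbf{P}(X_n=x)\big)$$ be the entropy of $X_n$. Suppose there is a constant $C>0$, independent of $x_0$, such that $E_n(x_0)\ge Cn$ for all $x_0\in V$ and all integers $n\ge 1$. Then simple random walk on $G$ is transient.
   Context: Graphs are undirected. Simple random walk on $G$ is the Markov chain on $V$ which at each step moves to a uniformly chosen neighbor of the current vertex. $\log$ is the natural logarithm and $0\log 0=0$; the entropy is a finite sum because all degrees are finite. The walk is transient if for every $x_0\in V$ the walk started at $x_0$ almost surely visits $x_0$ only finitely many times (equivalently $\sum_{t\ge 0}p^t(x_0,x_0)<\infty$, where $p$ is the transition matrix of the walk). *)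

theory Defs
  imports "HOL-Probability.Probability" "Graph_Theory.Digraph_Component"
begin

text \<open>
  A simple undirected graph is a \<^locale>\<open>pair_bidirected_digraph\<close>: its edge relation
  \<^term>\<open>parcs G\<close> is a symmetric, irreflexive relation on \<^term>\<open>pverts G\<close>, which may be infinite.
\<close>

definition nbrs :: "'a pair_pre_digraph \<Rightarrow> 'a \<Rightarrow> 'a set" where
  "nbrs G x = {y. (x, y) \<in> parcs G}"

definition has_max_degree :: "'a pair_pre_digraph \<Rightarrow> nat \<Rightarrow> bool" where
  "has_max_degree G d \<longleftrightarrow>
     (\<forall>x\<in>pverts G. finite (nbrs G x) \<and> card (nbrs G x) \<le> d) \<and>
     (\<exists>x\<in>pverts G. card (nbrs G x) = d)"

text \<open>
  Simple random walk is realised on the space of trajectories \<open>nat \<Rightarrow> 'a\<close>, with \<open>X\<^sub>n \<omega> = \<omega> n\<close>.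
  \<open>srw_kernel G x0 n \<omega>\<close> is the conditional law of \<open>X\<^sub>n\<close> given \<open>X\<^sub>i = \<omega> i\<close> for \<open>i < n\<close>.
  The value of \<^const>\<open>pmf_of_set\<close> is only meaningful on nonempty finite sets; in a connected
  infinite locally finite graph every \<open>nbrs G x\<close> with \<open>x \<in> pverts G\<close> is such a set.
\<close>

definition srw_kernel :: "'a pair_pre_digraph \<Rightarrow> 'a \<Rightarrow> nat \<Rightarrow> (nat \<Rightarrow> 'a) \<Rightarrow> 'a measure" where
  "srw_kernel G x0 n \<omega> =
     (case n of 0 \<Rightarrow> measure_pmf (return_pmf x0)
      | Suc m \<Rightarrow> measure_pmf (pmf_of_set (nbrs G (\<omega> m))))"

global_interpretation srw: Ionescu_Tulcea "srw_kernel G x0" "\<lambda>_. count_space UNIV"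
  for G :: "'a pair_pre_digraph" and x0 :: 'a
proof (rule Ionescu_Tulcea.intro)
  fix i :: nat
  show "srw_kernel G x0 i \<in>
      measurable (PiM {0..<i} (\<lambda>_. count_space UNIV)) (subprob_algebra (count_space UNIV))"
  proof (cases i)
    case 0
    have "measure_pmf (return_pmf x0) \<in> space (subprob_algebra (count_space UNIV))"
      by (simp add: space_subprob_algebra measure_pmf.subprob_space_axioms)
    then have "(\<lambda>_. measure_pmf (return_pmf x0)) \<in>
        measurable (PiM {0..<i} (\<lambda>_. count_space UNIV)) (subprob_algebra (count_space UNIV))"
      by (rule measurable_const)
    then show ?thesis
      by (simp add: 0 srw_kernel_def[abs_def])
  next
    case (Suc m)
    have 1: "(\<lambda>\<omega>. \<omega> m) \<in>
        measurable (PiM {0..<i} (\<lambda>_. count_space UNIV)) (count_space (UNIV :: 'a set))"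
      by (rule measurable_component_singleton) (simp add: Suc)
    have 2: "(\<lambda>x. measure_pmf (pmf_of_set (nbrs G x))) \<in>
        measurable (count_space UNIV) (subprob_algebra (count_space UNIV))"
      by (simp add: space_subprob_algebra measure_pmf.subprob_space_axioms)
    show ?thesis
      using measurable_compose[OF 1 2] unfolding Suc by (simp add: srw_kernel_def[abs_def])
  qed
next
  fix i :: nat and x :: "nat \<Rightarrow> 'a"
  show "prob_space (srw_kernel G x0 i x)"
    by (simp add: srw_kernel_def measure_pmf.prob_space_axioms split: nat.split)
qed

definition srw :: "'a pair_pre_digraph \<Rightarrow> 'a \<Rightarrow> (nat \<Rightarrow> 'a) measure" where
  "srw G x0 = srw.PF.lim G x0"

text \<open>In a locally finite graph only finitely many summands are nonzero, since \<open>0 * ln 0 = 0\<close>.\<close>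

definition srw_entropy :: "'a pair_pre_digraph \<Rightarrow> 'a \<Rightarrow> nat \<Rightarrow> real" where
  "srw_entropy G x0 n =
     - (\<Sum>\<^sub>\<infinity>x\<in>pverts G. \<P>(\<omega> in srw G x0. \<omega> n = x) * ln (\<P>(\<omega> in srw G x0. \<omega> n = x)))"

definition srw_transient :: "'a pair_pre_digraph \<Rightarrow> bool" where
  "srw_transient G \<longleftrightarrow> (\<forall>x0\<in>pverts G. AE \<omega> in srw G x0. finite {n. \<omega> n = x0})"

text \<open>The finite-dimensional distributions, confirming that \<^const>\<open>srw\<close> is the law of the Markov
  chain started at \<open>x0\<close> which moves to a uniformly chosen neighbour at each step.\<close>

lemma sets_srw: "sets (srw G x0) = sets (PiM UNIV (\<lambda>_. count_space UNIV))"
  by (simp add: srw_def)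

lemma space_srw: "space (srw G x0) = UNIV"
  using sets_eq_imp_space_eq[OF sets_srw] by (simp add: space_PiM)

lemma prob_space_srw: "prob_space (srw G x0)"
  proof
  have "emeasure (srw G x0) (space (srw G x0)) =
      emeasure (srw.CI G x0 {}) (space (srw.CI G x0 {}))"
    using srw.lim[of "{}" "space (srw.CI G x0 {})" G x0]
    by (simp add: srw_def srw.PF.space_P prod_emb_def space_PiM PiM_empty vimage_def restrict_def)
  then show "emeasure (srw G x0) (space (srw G x0)) = 1"
    by (simp add: prob_space.emeasure_space_1 srw.PF.prob_space_P)
qed

lemma sets_singleton_PiM:
  "finite J \<Longrightarrow> {restrict f J} \<in> sets (PiM J (\<lambda>_. count_space (UNIV :: 'a set)))"
proof -
  assume "finite J"
  then have "Pi\<^sub>E J (\<lambda>i. {f i}) \<in> sets (PiM J (\<lambda>_. count_space (UNIV :: 'a set)))"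
    by (intro sets_PiM_I_finite) auto
  also have "Pi\<^sub>E J (\<lambda>i. {f i}) = {restrict f J}"
    by (auto simp: PiE_iff extensional_def fun_eq_iff)
  finally show ?thesis .
qed

lemma emeasure_srw_C:
  "emeasure (srw.C G x0 0 n (\<lambda>_. undefined)) {restrict f {0..<n}} =
     (\<Prod>i<n. emeasure (srw_kernel G x0 i f) {f i})"
proof (induction n)
  case 0
  show ?case
    by (simp add: restrict_def PiM_empty emeasure_return)
next
  case (Suc n)
  let ?M = "\<lambda>_::nat. count_space (UNIV :: 'a set)"
  let ?C = "srw.C G x0 0 n (\<lambda>_. undefined)"
  let ?f = "restrict f {0..<Suc n}" and ?g = "restrict f {0..<n}"
  have u: "(\<lambda>_. undefined) \<in> space (PiM {0..<0} ?M)"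
    by (simp add: space_PiM)
  have sp: "space ?C = space (PiM {0..<n} ?M)"
    using srw.space_C[OF u, of G x0 n] by simp
  have st: "sets ?C = sets (PiM {0..<n} ?M)"
    using srw.sets_C[OF u, of G x0 n] by simp
  have f: "{?f} \<in> sets (PiM {0..<Suc n} ?M)"
    by (rule sets_singleton_PiM) simp
  have g: "{?g} \<in> sets ?C"
    unfolding st by (rule sets_singleton_PiM) simp
  have eP: "srw.eP G x0 n \<in> measurable ?C (subprob_algebra (PiM {0..<Suc n} ?M))"
    by (subst measurable_cong_sets[OF st refl]) (rule srw.measurable_eP)
  have k: "srw_kernel G x0 n ?g = srw_kernel G x0 n f"
    by (auto simp: srw_kernel_def split: nat.split)
  have ne: "space ?C \<noteq> {}"
    unfolding sp by (simp add: space_PiM PiE_eq_empty_iff)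
  have step: "emeasure (srw.eP G x0 n \<omega>) {?f} =
      emeasure (srw_kernel G x0 n f) {f n} * indicator {?g} \<omega>"
    if w: "\<omega> \<in> space ?C" for \<omega>
  proof -
    have w': "\<omega> \<in> space (PiM {0..<n} ?M)"
      using w sp by simp
    have ext: "\<omega> \<in> extensional {0..<n}"
      using w' by (auto simp: space_PiM PiE_iff)
    have "fun_upd \<omega> n x = ?f \<longleftrightarrow> \<omega> = ?g \<and> x = f n" for x
    proof
      assume h: "fun_upd \<omega> n x = ?f"
      have "x = f n"
        using fun_cong[OF h, of n] by simp
      moreover have "\<omega> i = ?g i" for i
        using fun_cong[OF h, of i] ext
        by (cases "i < n") (auto simp: extensional_def split: if_splits)
      ultimately show "\<omega> = ?g \<and> x = f n"
        by auto
    next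
      assume "\<omega> = ?g \<and> x = f n"
      then show "fun_upd \<omega> n x = ?f"
        by (auto simp: fun_eq_iff restrict_def less_Suc_eq)
    qed
    then have "fun_upd \<omega> n -` {?f} = (if \<omega> = ?g then {f n} else {})"
      by auto
    then show ?thesis
      using srw.emeasure_eP[OF w' f, where ?G = G and ?x0.0 = x0] k
      by (simp split: if_splits)
  qed
  have "emeasure (srw.C G x0 0 (Suc n) (\<lambda>_. undefined)) {?f} =
      (\<integral>\<^sup>+\<omega>. emeasure (srw.eP G x0 n \<omega>) {?f} \<partial>?C)"
    using emeasure_bind[OF ne eP f] by simp
  also have "\<dots> = (\<integral>\<^sup>+\<omega>. emeasure (srw_kernel G x0 n f) {f n} * indicator {?g} \<omega> \<partial>?C)"
    by (rule nn_integral_cong) (rule step)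
  also have "\<dots> = emeasure (srw_kernel G x0 n f) {f n} * emeasure ?C {?g}"
    by (rule nn_integral_cmult_indicator[OF g])
  finally show ?case
    by (simp add: Suc.IH mult.commute del: restrict_apply restrict_apply')
qed

lemma prob_srw_path:
  "\<P>(\<omega> in srw G x0. \<forall>i\<le>n. \<omega> i = f i) =
     (if f 0 = x0 then \<Prod>i<n. pmf (pmf_of_set (nbrs G (f i))) (f (Suc i)) else 0)"
proof -
  let ?M = "\<lambda>_::nat. count_space (UNIV :: 'a set)"
  let ?J = "{0..<Suc n}"
  have J: "{restrict f ?J} \<in> sets (PiM ?J ?M)"
    by (rule sets_singleton_PiM) simp
  have "{\<omega> \<in> space (srw G x0). \<forall>i\<le>n. \<omega> i = f i} = prod_emb UNIV ?M ?J {restrict f ?J}"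
    by (auto simp: space_srw prod_emb_def space_PiM fun_eq_iff restrict_def less_Suc_eq_le) metis
  then have "emeasure (srw G x0) {\<omega> \<in> space (srw G x0). \<forall>i\<le>n. \<omega> i = f i} =
      emeasure (srw.CI G x0 ?J) {restrict f ?J}"
    using srw.lim[OF _ J, where ?G = G and ?x0.0 = x0] by (simp add: srw_def)
  also have "\<dots> = emeasure (srw.C G x0 0 (Suc n) (\<lambda>_. undefined)) {restrict f ?J}"
    using srw.emeasure_CI[OF subset_refl J, where ?G = G and ?x0.0 = x0]
    by (simp add: prod_emb_id space_PiM PiE_iff extensional_def)
  also have "\<dots> = (\<Prod>i<Suc n. emeasure (srw_kernel G x0 i f) {f i})"
    by (rule emeasure_srw_C)
  also have "\<dots> = ennreal (if f 0 = x0 then \<Prod>i<n. pmf (pmf_of_set (nbrs G (f i))) (f (Suc i)) else 0)"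
    unfolding prod.lessThan_Suc_shift
    by (auto simp: srw_kernel_def emeasure_pmf_single prod_ennreal)
  finally show ?thesis
    by (simp add: measure_def prod_nonneg)
qed

end

theory Submission
  imports Defs
begin

text \<open>
  Linear entropy from every starting point makes the walk leave small sets quickly. If \<open>A\<close> is finite
  and the walk were in \<open>A\<close> at time \<open>n\<close> with probability close to 1, its entropy at time \<open>n\<close> would be
  essentially at most \<open>ln |A|\<close>; so for \<open>n\<close> a large multiple of \<open>ln |A|\<close> the walk is outside \<open>A\<close> with
  probability at least some \<open>c > 0\<close>, whatever its starting point (\<open>entropy_le_of_escape\<close>).

  Such an escape bound is a Faber--Krahn inequality. For \<open>f\<close> supported in \<open>A\<close>, with probability at least \<open>c\<close>
  the value of \<open>f\<close> changes from \<open>f x\<close> to 0 within \<open>n\<close> steps. The mean square change of \<open>f\<close> over \<open>n\<close>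
  steps is at most \<open>n\<^sup>2\<close> times that over one step, since the degree measure is invariant
  (\<open>displacement_energy\<close>). Hence \<open>c \<parallel>f\<parallel>\<^sup>2 \<le> n\<^sup>2 E(f)\<close>, where \<open>E\<close> is the Dirichlet energy and
  \<open>n\<close> is of order \<open>ln |A|\<close> (\<open>faber_krahn\<close>).

  Let \<open>u x\<close> be the expected number of visits to \<open>w\<close> before time \<open>m\<close>, starting from \<open>x\<close>. This is a
  finitely supported function whose Laplacian is at most the indicator of \<open>w\<close>, so its truncation to
  the band between the levels \<open>s < t\<close> has energy of order \<open>t - s\<close> at most (\<open>truncation_energy\<close>). On
  \<open>{u \<ge> t}\<close> the truncation equals \<open>t - s\<close>, and it is supported in \<open>{u > s}\<close>. If \<open>|{u > s}| \<le> 2\<^sup>k\<^sup>+\<^sup>1\<close>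
  and \<open>|{u \<ge> t}| \<ge> 2\<^sup>k\<close>, the Faber--Krahn inequality becomes
  \<open>2\<^sup>k (t - s)\<^sup>2 \<le> const \<cdot> (k + 2)\<^sup>2 (t - s)\<close>. So while the level sets of \<open>u\<close> double from size \<open>2\<^sup>k\<close>
  to \<open>2\<^sup>k\<^sup>+\<^sup>1\<close>, the level drops by at most a constant times \<open>(k + 2)\<^sup>2 / 2\<^sup>k\<close>. This is summable in \<open>k\<close>, which
  bounds \<open>max u\<close> uniformly in \<open>m\<close> (\<open>green_bounded\<close>). The expected number of returns is therefore
  finite, and the Borel--Cantelli lemma yields transience.
\<close>

section \<open>The transition operator\<close>

locale bounded_degree_graph = pair_bidirected_digraph G
  for G :: "'a pair_pre_digraph" +
  fixes d :: nat
  assumes finite_nbrs: "x \<in> pverts G \<Longrightarrow> finite (nbrs G x)"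
    and card_nbrs_le: "x \<in> pverts G \<Longrightarrow> card (nbrs G x) \<le> d"
    and nbrs_nonempty: "x \<in> pverts G \<Longrightarrow> nbrs G x \<noteq> {}"
begin

abbreviation N where "N \<equiv> nbrs G"
abbreviation V where "V \<equiv> pverts G"

definition avg :: "('a \<Rightarrow> real) \<Rightarrow> 'a \<Rightarrow> real" where
  "avg f x = (\<Sum>y\<in>N x. f y) / card (N x)"

text \<open>
  \<open>heat n f x\<close> is the expectation of \<open>f (X\<^sub>n)\<close> for the walk started at \<open>x\<close>. Working with this operator on
  arbitrary functions keeps the trajectory space out of the potential theory.
\<close>

definition heat :: "nat \<Rightarrow> ('a \<Rightarrow> real) \<Rightarrow> 'a \<Rightarrow> real" where
  "heat n = avg ^^ n"

lemma heat_0 [simp]: "heat 0 f = f"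
  by (simp add: heat_def)

lemma heat_Suc: "heat (Suc n) f = avg (heat n f)"
  by (simp add: heat_def)

lemma nbrs_subset: "N x \<subseteq> V"
  by (auto simp: nbrs_def dest: in_arcsD2)

lemma nbrs_outside: "x \<notin> V \<Longrightarrow> N x = {}"
  by (auto simp: nbrs_def dest: in_arcsD1)

lemma finite_N [simp, intro]: "finite (N x)"
  using finite_nbrs[of x] nbrs_outside[of x] by (cases "x \<in> V") auto

lemma card_N: "card (N x) \<le> d"
  using card_nbrs_le[of x] nbrs_outside[of x] by (cases "x \<in> V") auto

lemma card_N_pos: "x \<in> V \<Longrightarrow> 0 < card (N x)"
  using nbrs_nonempty by (simp add: card_gt_0_iff)

lemma N_sym: "y \<in> N x \<longleftrightarrow> x \<in> N y"
  by (auto simp: nbrs_def arcs_symmetric)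

lemma card_mult_avg: "card (N x) * avg f x = (\<Sum>y\<in>N x. f y)"
  by (cases "N x = {}") (auto simp: avg_def)

lemma avg_mono: "(\<And>y. y \<in> N x \<Longrightarrow> f y \<le> g y) \<Longrightarrow> avg f x \<le> avg g x"
  by (auto simp: avg_def intro!: divide_right_mono sum_mono)

lemma avg_add: "avg (\<lambda>y. f y + g y) x = avg f x + avg g x"
  by (simp add: avg_def sum.distrib add_divide_distrib)

lemma avg_cmult: "avg (\<lambda>y. c * f y) x = c * avg f x"
  by (simp add: avg_def sum_distrib_left)

lemma avg_const: "x \<in> V \<Longrightarrow> avg (\<lambda>_. c) x = c"
  using nbrs_nonempty[of x] by (simp add: avg_def)

lemma heat_mono: "(\<And>y. f y \<le> g y) \<Longrightarrow> heat n f x \<le> heat n g x"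
proof (induction n arbitrary: x)
  case (Suc n)
  then show ?case unfolding heat_Suc by (intro avg_mono) auto
qed simp

lemma heat_add: "heat n (\<lambda>y. f y + g y) = (\<lambda>x. heat n f x + heat n g x)"
proof (induction n)
  case (Suc n)
  then show ?case by (auto simp: heat_Suc avg_add)
qed simp

lemma heat_cmult: "heat n (\<lambda>y. c * f y) = (\<lambda>x. c * heat n f x)"
proof (induction n)
  case (Suc n)
  then show ?case by (auto simp: heat_Suc avg_cmult)
qed simp

lemma heat_zero: "heat n (\<lambda>_. 0) x = 0"
  using fun_cong[OF heat_cmult[of n 0 "\<lambda>_. 0"], of x] by simp

lemma heat_nonneg: "(\<And>y. 0 \<le> f y) \<Longrightarrow> 0 \<le> heat n f x"
  using heat_mono[of "\<lambda>_. 0" f n x] by (simp add: heat_zero)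

lemma heat_const: "x \<in> V \<Longrightarrow> heat n (\<lambda>_. c) x = c"
proof (induction n arbitrary: x)
  case (Suc n)
  have "avg (heat n (\<lambda>_. c)) x = avg (\<lambda>_. c) x"
    unfolding avg_def using Suc.IH nbrs_subset by (metis (no_types, lifting) subsetD sum.cong)
  then show ?case by (simp add: heat_Suc avg_const Suc.prems)
qed simp

lemma heat_sum: "finite I \<Longrightarrow> heat n (\<lambda>y. \<Sum>i\<in>I. f i y) x = (\<Sum>i\<in>I. heat n (f i) x)"
  by (induction I rule: finite_induct) (auto simp: heat_zero heat_add)

lemma finite_support_heat: "finite {x. f x \<noteq> 0} \<Longrightarrow> finite {x. heat n f x \<noteq> 0}"
proof (induction n)
  case (Suc n)
  have "{x. avg (heat n f) x \<noteq> 0} \<subseteq> (\<Union>y\<in>{y. heat n f y \<noteq> 0}. N y)"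
  proof clarify
    fix x assume "avg (heat n f) x \<noteq> 0"
    then have "\<exists>y\<in>N x. heat n f y \<noteq> 0"
      by (auto simp: avg_def intro: ccontr)
    then show "x \<in> (\<Union>y\<in>{y. heat n f y \<noteq> 0}. N y)" using N_sym by auto
  qed
  then show ?case unfolding heat_Suc
    by (rule finite_subset) (use Suc in auto)
qed simp

section \<open>Reachable vertices\<close>

primrec reach :: "nat \<Rightarrow> 'a \<Rightarrow> 'a set" where
  "reach 0 x = {x}"
| "reach (Suc n) x = (\<Union>y\<in>N x. reach n y)"

lemma finite_reach [simp, intro]: "finite (reach n x)"
  by (induction n arbitrary: x) auto

lemma reach_subset: "x \<in> V \<Longrightarrow> reach n x \<subseteq> V"
proof (induction n arbitrary: x)
  case (Suc n)
  then show ?case using nbrs_subset[of x] by (simp add: UN_least subsetD)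
qed simp

lemma card_reach: "card (reach n x) \<le> d ^ n"
proof (induction n arbitrary: x)
  case (Suc n)
  have "card (reach (Suc n) x) \<le> (\<Sum>y\<in>N x. card (reach n y))"
    by (simp add: card_UN_le)
  also have "\<dots> \<le> (\<Sum>y\<in>N x. d ^ n)" by (intro sum_mono Suc)
  also have "\<dots> \<le> d * d ^ n" using card_N[of x] by simp
  finally show ?case by simp
qed simp

lemma heat_cong_reach: "(\<And>y. y \<in> reach n x \<Longrightarrow> f y = g y) \<Longrightarrow> heat n f x = heat n g x"
proof (induction n arbitrary: x)
  case (Suc n)
  have "heat n f y = heat n g y" if "y \<in> N x" for y
    using that Suc.prems by (intro Suc.IH) auto
  then show ?case by (simp add: heat_Suc avg_def)
qed simp

text \<open>Recovers expectations from point probabilities; constant \<open>f\<close> gives total mass 1.\<close>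

lemma heat_expand:
  "heat n f x = (\<Sum>y\<in>reach n x. f y * heat n (indicator {y}) x)"
proof -
  have "heat n f x = heat n (\<lambda>z. \<Sum>y\<in>reach n x. f y * indicator {y} z) x"
  proof (rule heat_cong_reach)
    fix z assume "z \<in> reach n x"
    then show "f z = (\<Sum>y\<in>reach n x. f y * indicator {y} z)"
      by (subst sum.remove[of _ z]) (auto intro!: sum.neutral simp: indicator_def)
  qed
  also have "\<dots> = (\<Sum>y\<in>reach n x. f y * heat n (indicator {y}) x)"
    unfolding heat_sum[OF finite_reach] heat_cmult ..
  finally show ?thesis .
qed

lemma heat_outside_reach: "y \<notin> reach n x \<Longrightarrow> heat n (indicator {y}) x = 0"
  using heat_cong_reach[of n x "indicator {y}" "\<lambda>_. 0"] by (auto simp: heat_zero indicator_def)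

end

section \<open>Entropy and escape from finite sets\<close>

text \<open>
  Gibbs' inequality. Only the total masses are compared, which allows \<open>q\<close> to be a convenient
  subprobability weight.
\<close>

lemma gibbs:
  fixes p q :: "'b \<Rightarrow> real"
  assumes "finite R" and p: "\<And>y. y \<in> R \<Longrightarrow> 0 \<le> p y" and q: "\<And>y. y \<in> R \<Longrightarrow> 0 < q y"
    and "(\<Sum>y\<in>R. q y) \<le> (\<Sum>y\<in>R. p y)"
  shows "- (\<Sum>y\<in>R. p y * ln (p y)) \<le> - (\<Sum>y\<in>R. p y * ln (q y))"
proof -
  have "p y * ln (q y) - p y * ln (p y) \<le> q y - p y" if "y \<in> R" for y
  proof (cases "p y = 0")
    case True then show ?thesis using q[OF that] by simp
  next
    case False
    then have pp: "p y > 0" using p[OF that] by simp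
    have "ln (q y / p y) \<le> q y / p y - 1"
      using pp q[OF that] by (intro ln_le_minus_one) simp
    then have "p y * ln (q y / p y) \<le> p y * (q y / p y - 1)"
      using pp by (intro mult_left_mono) auto
    then show ?thesis using pp q[OF that]
      by (simp add: ln_div algebra_simps)
  qed
  then have "(\<Sum>y\<in>R. p y * ln (q y) - p y * ln (p y)) \<le> (\<Sum>y\<in>R. q y - p y)"
    by (rule sum_mono)
  then show ?thesis using assms(4) by (simp add: sum_subtractf)
qed

context bounded_degree_graph
begin

text \<open>
  Compare the law of the walk with the measure that spreads mass at most \<open>1/2\<close> evenly over \<open>A\<close>
  and mass at most \<open>1/2\<close> evenly over the reachable vertices outside \<open>A\<close>, of which there are at most \<open>d ^ n\<close>. The base \<open>d + 1\<close> instead of \<open>d\<close> makes the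
  logarithm strictly positive.
\<close>

lemma entropy_le_of_escape:
  fixes A :: "'a set" and a :: real
  assumes x: "x \<in> V" and A: "finite A" "card A \<le> a" "1 \<le> a"
  shows "- (\<Sum>y\<in>reach n x. heat n (indicator {y}) x * ln (heat n (indicator {y}) x))
         \<le> ln (2 * a) + n * ln (real d + 1) * heat n (indicator (- A)) x"
proof -
  define p where "p y = heat n (indicator {y}) x" for y
  define R where "R = reach n x"
  define b where "b = (real d + 1) ^ n"
  define q where "q y = (if y \<in> A then 1 / (2 * a) else 1 / (2 * b))" for y
  have b: "b \<ge> 1" unfolding b_def by simp
  have R: "finite R" by (simp add: R_def)
  have sump: "(\<Sum>y\<in>R. p y) = 1"
    using heat_expand[of n "\<lambda>_. 1" x] heat_const[OF x] by (simp add: R_def p_def)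
  have cardR: "real (card R) \<le> b"
  proof -
    have "real (card R) \<le> real d ^ n" using card_reach[of n x] by (simp add: R_def flip: of_nat_power)
    also have "\<dots> \<le> b" unfolding b_def by (intro power_mono) auto
    finally show ?thesis .
  qed
  have "(\<Sum>y\<in>R. q y) = (\<Sum>y\<in>R\<inter>A. 1 / (2*a)) + (\<Sum>y\<in>R-A. 1 / (2*b))"
    unfolding q_def using R by (subst sum.If_cases) (auto simp: Diff_eq)
  also have "\<dots> \<le> 1/2 + 1/2"
  proof (rule add_mono)
    have "real (card (R \<inter> A)) \<le> a"
      using card_mono[of A "R \<inter> A"] A by simp
    then show "(\<Sum>y\<in>R\<inter>A. 1 / (2*a)) \<le> 1/2" using A by (simp add: field_simps)
    have "real (card (R - A)) \<le> b"
      using card_mono[of R "R - A"] R cardR by simp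
    then show "(\<Sum>y\<in>R-A. 1 / (2*b)) \<le> 1/2" using b by (simp add: field_simps)
  qed
  finally have sumq: "(\<Sum>y\<in>R. q y) \<le> (\<Sum>y\<in>R. p y)" using sump by simp
  have "- (\<Sum>y\<in>R. p y * ln (p y)) \<le> - (\<Sum>y\<in>R. p y * ln (q y))"
    using A b sumq R by (intro gibbs) (auto simp: p_def q_def intro!: heat_nonneg)
  also have "\<dots> \<le> (\<Sum>y\<in>R. p y * (ln (2*a) + n * ln (real d + 1) * indicator (- A) y))"
  proof -
    have "- ln (q y) \<le> ln (2*a) + n * ln (real d + 1) * indicator (- A) y" for y
      using A b ln_ge_zero[of a] by (auto simp: q_def ln_div ln_mult b_def ln_realpow)
    then show ?thesis unfolding sum_negf[symmetric]
      by (intro sum_mono) (metis mult_left_mono mult_minus_right heat_nonneg indicator_pos_le p_def)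
  qed
  also have "\<dots> = ln (2*a) * (\<Sum>y\<in>R. p y) + n * ln (real d + 1) * (\<Sum>y\<in>R. indicator (- A) y * p y)"
    by (simp add: sum.distrib distrib_left sum_distrib_left mult_ac flip: sum_distrib_right)
  also have "(\<Sum>y\<in>R. indicator (- A) y * p y) = heat n (indicator (- A)) x"
    unfolding heat_expand[of n "indicator (- A)"] R_def p_def ..
  finally show ?thesis by (simp add: sump) (simp add: R_def p_def)
qed

section \<open>Dirichlet energy\<close>

text \<open>
  This is the triangle inequality in the \<open>L\<^sup>2\<close> space of the walk started from the degree measure: a
  displacement over \<open>n\<close> steps is a sum of \<open>n\<close> one-step displacements of norm at most \<open>\<surd>E\<close> each. Quantifying over
  all finite \<open>S\<close>, in the hypothesis and the conclusion, replaces sums over all vertices: a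
  step moves the starting set \<open>S\<close> to the set of its neighbours.
\<close>

lemma displacement_energy:
  fixes f :: "'a \<Rightarrow> real"
  assumes E: "\<And>S. finite S \<Longrightarrow> (\<Sum>x\<in>S. \<Sum>y\<in>N x. (f x - f y)\<^sup>2) \<le> E"
    and "finite S"
  shows "(\<Sum>x\<in>S. card (N x) * heat n (\<lambda>z. (f x - f z)\<^sup>2) x) \<le> (real n)\<^sup>2 * E"
  using \<open>finite S\<close>
proof (induction n arbitrary: S)
  case 0
  then show ?case by simp
next
  case (Suc n)
  show ?case
  proof (cases "n = 0")
    case True
    then show ?thesis using E[OF Suc.prems] by (simp add: heat_Suc card_mult_avg)
  next
    case False
    define Q where "Q y = heat n (\<lambda>z. (f y - f z)\<^sup>2) y" for y
    define T where "T = (\<Union>x\<in>S. N x)"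
    have T: "finite T" using Suc.prems by (simp add: T_def)
    have Q0: "Q y \<ge> 0" for y unfolding Q_def by (intro heat_nonneg) simp
    \<comment> \<open>The weights are those for which the factors \<open>n\<^sup>2\<close> reproduce themselves:
      \<open>(1 + n) + (1 + 1/n) n\<^sup>2 = (n + 1)\<^sup>2\<close>.\<close>
    have ineq: "(a + b)\<^sup>2 \<le> (1 + real n) * a\<^sup>2 + (1 + 1 / n) * b\<^sup>2" for a b :: real
    proof -
      have "(1 + real n) * a\<^sup>2 + (1 + 1 / n) * b\<^sup>2 - (a + b)\<^sup>2 = (n * a - b)\<^sup>2 / n"
        using False by (simp add: field_simps power2_eq_square)
      also have "\<dots> \<ge> 0" by simp
      finally show ?thesis by simp
    qed
    have 1: "heat n (\<lambda>z. (f x - f z)\<^sup>2) y \<le> (1 + real n) * (f x - f y)\<^sup>2 + (1 + 1 / n) * Q y"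
      if "y \<in> V" for x y
    proof -
      have "heat n (\<lambda>z. (f x - f z)\<^sup>2) y
          \<le> heat n (\<lambda>z. (1 + real n) * (f x - f y)\<^sup>2 + (1 + 1 / n) * (f y - f z)\<^sup>2) y"
        by (rule heat_mono) (use ineq[of "f x - f y" "f y - f _"] in simp)
      then show ?thesis unfolding Q_def by (simp add: heat_add heat_cmult heat_const[OF that])
    qed
    have "(\<Sum>x\<in>S. card (N x) * heat (Suc n) (\<lambda>z. (f x - f z)\<^sup>2) x)
        = (\<Sum>x\<in>S. \<Sum>y\<in>N x. heat n (\<lambda>z. (f x - f z)\<^sup>2) y)"
      by (simp add: heat_Suc card_mult_avg)
    also have "\<dots> \<le> (\<Sum>x\<in>S. \<Sum>y\<in>N x. (1 + real n) * (f x - f y)\<^sup>2 + (1 + 1 / n) * Q y)"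
      using 1 nbrs_subset by (intro sum_mono) auto
    also have "\<dots> = (1 + real n) * (\<Sum>x\<in>S. \<Sum>y\<in>N x. (f x - f y)\<^sup>2)
        + (1 + 1 / n) * (\<Sum>x\<in>S. \<Sum>y\<in>N x. Q y)"
      by (simp add: sum.distrib sum_distrib_left)
    \<comment> \<open>Invariance of the degree measure: a vertex \<open>y\<close> is counted once per neighbour in \<open>S\<close>.\<close>
    also have "(\<Sum>x\<in>S. \<Sum>y\<in>N x. Q y) \<le> (real n)\<^sup>2 * E"
    proof -
      have "(\<Sum>x\<in>S. \<Sum>y\<in>N x. Q y) = (\<Sum>x\<in>S. \<Sum>y\<in>{y\<in>T. y \<in> N x}. Q y)"
        by (intro sum.cong) (auto simp: T_def)
      also have "\<dots> = (\<Sum>y\<in>T. \<Sum>x\<in>{x\<in>S. y \<in> N x}. Q y)"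
        by (rule sum.swap_restrict[OF Suc.prems T])
      also have "\<dots> \<le> (\<Sum>y\<in>T. card (N y) * Q y)"
      proof (rule sum_mono)
        fix y
        have "card {x\<in>S. y \<in> N x} \<le> card (N y)"
          using N_sym by (intro card_mono) auto
        then show "(\<Sum>x\<in>{x\<in>S. y \<in> N x}. Q y) \<le> card (N y) * Q y"
          using Q0[of y] by (simp add: mult_right_mono)
      qed
      also have "\<dots> \<le> (real n)\<^sup>2 * E" unfolding Q_def by (rule Suc.IH[OF T])
      finally show ?thesis .
    qed
    finally have "(\<Sum>x\<in>S. card (N x) * heat (Suc n) (\<lambda>z. (f x - f z)\<^sup>2) x)
       \<le> (1 + real n) * E + (1 + 1 / n) * ((real n)\<^sup>2 * E)"
      using E[OF Suc.prems] by (smt (verit) mult_left_mono of_nat_0_le_iff divide_nonneg_nonneg)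
    also have "\<dots> = (real (Suc n))\<^sup>2 * E"
      using False by (simp add: field_simps power2_eq_square)
    finally show ?thesis .
  qed
qed

text \<open>
  A walk from \<open>x \<in> A\<close> that is outside \<open>A\<close> at time \<open>n\<close> contributes \<open>(f x)\<^sup>2\<close> to the mean square displacement
  of \<open>f\<close>, and this happens with probability at least \<open>c\<close>.
\<close>

lemma faber_krahn:
  fixes f :: "'a \<Rightarrow> real"
  assumes E: "\<And>S. finite S \<Longrightarrow> (\<Sum>x\<in>S. \<Sum>y\<in>N x. (f x - f y)\<^sup>2) \<le> E"
    and A: "finite A" "A \<subseteq> V" and supp: "\<And>x. x \<notin> A \<Longrightarrow> f x = 0"
    and esc: "\<And>x. x \<in> A \<Longrightarrow> c \<le> heat n (indicator (- A)) x"
  shows "c * (\<Sum>x\<in>A. (f x)\<^sup>2) \<le> (real n)\<^sup>2 * E"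
proof -
  have "c * (\<Sum>x\<in>A. (f x)\<^sup>2) = (\<Sum>x\<in>A. (f x)\<^sup>2 * c)"
    by (simp add: sum_distrib_left mult.commute)
  also have "\<dots> \<le> (\<Sum>x\<in>A. card (N x) * heat n (\<lambda>z. (f x - f z)\<^sup>2) x)"
  proof (rule sum_mono)
    fix x assume x: "x \<in> A"
    have "(f x)\<^sup>2 * c \<le> (f x)\<^sup>2 * heat n (indicator (- A)) x"
      using esc[OF x] by (intro mult_left_mono) auto
    also have "\<dots> = heat n (\<lambda>z. (f x)\<^sup>2 * indicator (- A) z) x" by (simp add: heat_cmult)
    also have "\<dots> \<le> heat n (\<lambda>z. (f x - f z)\<^sup>2) x"
      by (rule heat_mono) (auto simp: indicator_def supp)
    also have "\<dots> \<le> card (N x) * heat n (\<lambda>z. (f x - f z)\<^sup>2) x"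
    proof -
      have "0 \<le> heat n (\<lambda>z. (f x - f z)\<^sup>2) x" by (intro heat_nonneg) simp
      moreover have "1 \<le> real (card (N x))" using card_N_pos[of x] x A by force
      ultimately show ?thesis by (simp add: mult_le_cancel_right1)
    qed
    finally show "(f x)\<^sup>2 * c \<le> card (N x) * heat n (\<lambda>z. (f x - f z)\<^sup>2) x" .
  qed
  also have "\<dots> \<le> (real n)\<^sup>2 * E" by (rule displacement_energy[OF E A(1)])
  finally show ?thesis .
qed

text \<open>
  Summation by parts. The set \<open>T\<close> has to contain all edges that meet the support of \<open>f\<close>, so that no
  boundary term appears.
\<close>

lemma green_identity:
  fixes f g :: "'a \<Rightarrow> real"
  assumes T: "finite T" and F: "F \<subseteq> T" "\<And>x. x \<in> F \<Longrightarrow> N x \<subseteq> T" "\<And>x. x \<notin> F \<Longrightarrow> f x = 0"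
  shows "(\<Sum>x\<in>T. \<Sum>y\<in>N x. (f x - f y) * (g x - g y))
       = 2 * (\<Sum>x\<in>T. f x * (card (N x) * (g x - avg g x)))"
proof -
  have cut: "(\<Sum>y\<in>N x. (f x - f y) * (g x - g y)) = (\<Sum>y\<in>{y\<in>T. y \<in> N x}. (f x - f y) * (g x - g y))"
    if "x \<in> T" for x
  proof (rule sum.mono_neutral_right)
    show "\<forall>y\<in>N x - {y \<in> T. y \<in> N x}. (f x - f y) * (g x - g y) = 0"
      using F by auto (metis subsetD)
  qed auto
  have inner: "(\<Sum>y\<in>{y\<in>T. y \<in> N x}. f x * (g x - g y)) = f x * (card (N x) * (g x - avg g x))" for x
  proof (cases "x \<in> F")
    case True
    then have "{y\<in>T. y \<in> N x} = N x" using F by auto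
    then show ?thesis
      by (simp add: right_diff_distrib card_mult_avg sum_subtractf flip: sum_distrib_left)
  qed (simp add: F)
  have "(\<Sum>x\<in>T. \<Sum>y\<in>N x. (f x - f y) * (g x - g y))
     = (\<Sum>x\<in>T. \<Sum>y\<in>{y\<in>T. y \<in> N x}. f x * (g x - g y))
     + (\<Sum>x\<in>T. \<Sum>y\<in>{y\<in>T. y \<in> N x}. f y * (g y - g x))"
    unfolding sum.distrib[symmetric]
    by (rule sum.cong[OF refl], subst cut, assumption, rule sum.cong[OF refl]) (simp add: algebra_simps)
  also have "(\<Sum>x\<in>T. \<Sum>y\<in>{y\<in>T. y \<in> N x}. f y * (g y - g x))
     = (\<Sum>y\<in>T. \<Sum>x\<in>{x\<in>T. y \<in> N x}. f y * (g y - g x))"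
    by (rule sum.swap_restrict[OF T T])
  also have "\<dots> = (\<Sum>x\<in>T. \<Sum>y\<in>{y\<in>T. y \<in> N x}. f x * (g x - g y))"
    using N_sym by (intro sum.cong) auto
  finally show ?thesis by (simp add: inner)
qed

text \<open>
  As \<open>f\<close> is a nondecreasing 1-Lipschitz function of \<open>u\<close>, the energy of \<open>f\<close> is at most the mixed energy of \<open>f\<close>
  and \<open>u\<close>; by Green's identity, the latter pairs \<open>f\<close>, which is at most \<open>t - s\<close>, with the Laplacian of \<open>u\<close>.
\<close>

lemma truncation_energy:
  fixes u f :: "'a \<Rightarrow> real" and s t :: real
  assumes fin: "finite {x. u x \<noteq> 0}"
    and super: "\<And>x. x \<in> V \<Longrightarrow> u x - avg u x \<le> indicator {w} x"
    and st: "0 \<le> s" "s \<le> t" and S: "finite S"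
    and f: "\<And>x. f x = min (max (u x - s) 0) (t - s)"
  shows "(\<Sum>x\<in>S. \<Sum>y\<in>N x. (f x - f y)\<^sup>2) \<le> 2 * d * (t - s)"
proof -
  define F where "F = {x. u x \<noteq> 0}"
  define T where "T = insert w (S \<union> F \<union> (\<Union>x\<in>F. N x))"
  have T: "finite T" using S fin by (simp add: T_def F_def)
  have f0: "f x = 0" if "x \<notin> F" for x
    using that st by (simp add: F_def f)
  have f_bd: "0 \<le> f x" "f x \<le> t - s" for x using st by (auto simp: f)
  have "(\<Sum>x\<in>S. \<Sum>y\<in>N x. (f x - f y)\<^sup>2) \<le> (\<Sum>x\<in>T. \<Sum>y\<in>N x. (f x - f y)\<^sup>2)"
    using T by (intro sum_mono2) (auto simp: T_def intro!: sum_nonneg)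
  also have "\<dots> \<le> (\<Sum>x\<in>T. \<Sum>y\<in>N x. (f x - f y) * (u x - u y))"
  proof (intro sum_mono)
    fix x y
    have *: "(f x - f y)\<^sup>2 \<le> (f x - f y) * (u x - u y)" if "u y \<le> u x" for x y
    proof -
      have "0 \<le> f x - f y" "f x - f y \<le> u x - u y" using that by (auto simp: f)
      then show ?thesis by (simp add: power2_eq_square mult_left_mono)
    qed
    show "(f x - f y)\<^sup>2 \<le> (f x - f y) * (u x - u y)"
      using *[of x y] *[of y x] by (cases "u y \<le> u x") (auto simp: power2_eq_square algebra_simps)
  qed
  also have "\<dots> = 2 * (\<Sum>x\<in>T. f x * (card (N x) * (u x - avg u x)))"
    by (rule green_identity[OF T, of F]) (auto simp: T_def f0)
  also have "(\<Sum>x\<in>T. f x * (card (N x) * (u x - avg u x)))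
      \<le> (\<Sum>x\<in>T. if x = w then f x * card (N x) else 0)"
  proof (rule sum_mono)
    fix x
    have "card (N x) * (u x - avg u x) \<le> card (N x) * (indicator {w} x :: real)"
    proof (cases "x \<in> V")
      case True then show ?thesis by (intro mult_left_mono super) auto
    qed (simp add: nbrs_outside)
    then have "f x * (card (N x) * (u x - avg u x)) \<le> f x * (card (N x) * (indicator {w} x :: real))"
      using f_bd(1)[of x] by (rule mult_left_mono)
    then show "f x * (card (N x) * (u x - avg u x)) \<le> (if x = w then f x * card (N x) else 0)"
      by (auto simp: indicator_def split: if_splits)
  qed
  also have "\<dots> = f w * card (N w)"
    using T by (simp add: T_def)
  also have "\<dots> \<le> (t - s) * d"
    using f_bd card_N[of w] st by (intro mult_mono) auto
  finally show ?thesis by (simp add: algebra_simps)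
qed

end

section \<open>Level sets and the Green function\<close>

text \<open>
  If \<open>b k\<close> bounds every drop of level during which the level sets grow from size \<open>2\<^sup>k\<close> to size \<open>2\<^sup>k\<^sup>+\<^sup>1\<close>,
  then the whole range of \<open>u\<close> is bounded by the sum of the \<open>b k\<close>: telescope along levels \<open>s k\<close>, where
  \<open>s k\<close> is the least \<open>r\<close> among 0 and the values of \<open>u\<close> with \<open>|{u > r}| < 2\<^sup>k\<close>. The number of summands is not controlled, so the
  lemma is useful for summable \<open>b\<close>.
\<close>

lemma level_set_chain:
  fixes u :: "'b \<Rightarrow> real" and b :: "nat \<Rightarrow> real"
  assumes fin: "finite {x. u x \<noteq> 0}" and nonneg: "\<And>x. 0 \<le> u x" and b: "\<And>k. 0 \<le> b k"
    and step: "\<And>s t k. 0 \<le> s \<Longrightarrow> s < t \<Longrightarrow> card {x. s < u x} \<le> 2 ^ Suc k \<Longrightarrow>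
       2 ^ k \<le> card {x. t \<le> u x} \<Longrightarrow> t - s \<le> b k"
  shows "\<exists>K. u x \<le> (\<Sum>k<K. b k)"
proof -
  define vals where "vals = insert 0 (range u)"
  have "range u \<subseteq> insert 0 (u ` {x. u x \<noteq> 0})" by auto
  then have fv: "finite vals"
    unfolding vals_def using fin by (meson finite.insertI finite_imageI finite_subset)
  have finl: "finite {x. s < u x}" if "0 \<le> s" for s
    using fin by (rule rev_finite_subset) (use that in auto)
  define L where "L k = {s\<in>vals. card {x. s < u x} < 2 ^ k}" for k :: nat
  have top: "Max vals \<in> L k" for k
  proof -
    have "{x. Max vals < u x} = {}" using fv Max_ge[OF fv] by (auto simp: vals_def not_less)
    then show ?thesis using Max_in[OF fv] by (auto simp: L_def vals_def)
  qed
  define s where "s k = Min (L k)" for k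
  have finL: "finite (L k)" for k using fv by (simp add: L_def)
  have sL: "s k \<in> L k" for k
    unfolding s_def using finL top by (intro Min_in) auto
  have s_le: "s k \<le> r" if "r \<in> L k" for r k
    unfolding s_def using finL that by (intro Min_le) auto
  have s0: "0 \<le> s k" for k using sL[of k] nonneg by (auto simp: L_def vals_def)
  \<comment> \<open>Otherwise the next smaller candidate \<open>r\<close> would qualify too, as \<open>{u > r} = {u \<ge> s k}\<close>.\<close>
  have big: "2 ^ k \<le> card {x. s k \<le> u x}" if pos: "0 < s k" for k
  proof (rule ccontr)
    assume less: "\<not> 2 ^ k \<le> card {x. s k \<le> u x}"
    define B where "B = {r\<in>vals. r < s k}"
    have B: "finite B" "0 \<in> B" using fv pos by (auto simp: B_def vals_def)
    define r where "r = Max B"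
    have r: "r \<in> B" unfolding r_def using B by (intro Max_in) auto
    have "{x. r < u x} \<subseteq> {x. s k \<le> u x}"
    proof (clarify, rule ccontr)
      fix x assume "r < u x" "\<not> s k \<le> u x"
      then have "u x \<in> B" by (auto simp: B_def vals_def)
      then show False using Max_ge[OF B(1)] \<open>r < u x\<close> by (fastforce simp: r_def)
    qed
    then have "card {x. r < u x} \<le> card {x. s k \<le> u x}"
      using fin pos by (intro card_mono finite_subset[of "{x. s k \<le> u x}" "{x. u x \<noteq> 0}"]) auto
    then have "r \<in> L k" using r less by (auto simp: L_def B_def)
    then show False using s_le[of r k] r by (auto simp: B_def)
  qed
  have diff: "s k - s (Suc k) \<le> b k" for k
  proof (cases "s (Suc k) < s k")
    case True
    then show ?thesis using sL[of "Suc k"] s0[of "Suc k"] big[of k]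
      by (intro step) (auto simp: L_def)
  next
    case False then show ?thesis using b[of k] by simp
  qed
  have tele: "s 0 \<le> s K + (\<Sum>k<K. b k)" for K
  proof (induction K)
    case (Suc K) then show ?case using diff[of K] by simp
  qed simp
  have ux: "u x \<le> s 0"
  proof -
    have "finite {x. s 0 < u x}" "card {x. s 0 < u x} = 0" using sL[of 0] finl[OF s0] by (auto simp: L_def)
    then have "{x. s 0 < u x} = {}" by simp
    then show ?thesis by (auto simp: not_less)
  qed
  define K where "K = card {x. 0 < u x}"
  have "0 \<in> L K" using less_exp[of K] by (simp add: L_def vals_def K_def)
  then have "s K = 0" using s_le[of 0 K] s0[of K] by simp
  then show ?thesis using tele[of K] ux by (intro exI[of _ K]) simp
qed

lemma sum_quadratic_over_power2: "(\<Sum>k<K. (real k + 2)\<^sup>2 / 2 ^ k) \<le> 22"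
proof -
  \<comment> \<open>The summand is the decrement of \<open>(2 k\<^sup>2 + 12 k + 22) / 2\<^sup>k\<close>.\<close>
  have "(\<Sum>k<K. (real k + 2)\<^sup>2 / 2 ^ k) = 22 - (2 * (real K)\<^sup>2 + 12 * K + 22) / 2 ^ K"
  proof (induction K)
    case (Suc K)
    show ?case unfolding sum.lessThan_Suc Suc by (simp add: field_simps power2_eq_square)
  qed simp
  then show ?thesis by simp
qed

context bounded_degree_graph
begin

text \<open>
  Cutting the Green function off at a finite time keeps its support finite, and the cut-off only
  helps: the Laplacian acquires the negative term \<open>- P\<^sub>x(X\<^sub>n = w)\<close>.
\<close>

definition green :: "'a \<Rightarrow> nat \<Rightarrow> 'a \<Rightarrow> real" where
  "green w n x = (\<Sum>k<n. heat k (indicator {w}) x)"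

lemma green_nonneg: "0 \<le> green w n x"
  unfolding green_def by (intro sum_nonneg heat_nonneg) simp

lemma finite_support_green: "finite {x. green w n x \<noteq> 0}"
proof -
  have "{x. green w n x \<noteq> 0} \<subseteq> (\<Union>k<n. {x. heat k (indicator {w}) x \<noteq> 0})"
    by (auto simp: green_def intro: ccontr)
  moreover have "finite {x. heat k (indicator {w}) x \<noteq> 0}" for k
    by (rule finite_support_heat) (simp add: indicator_def)
  ultimately show ?thesis
    by (rule finite_subset[OF _ finite_UN_I[OF finite_lessThan]])
qed

lemma green_outside: "x \<notin> V \<Longrightarrow> w \<in> V \<Longrightarrow> green w n x = 0"
proof -
  assume "x \<notin> V" "w \<in> V"
  have "heat k (indicator {w}) x = 0" for k
    using \<open>x \<notin> V\<close> \<open>w \<in> V\<close> by (cases k) (auto simp: heat_Suc avg_def nbrs_outside indicator_def)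
  then show ?thesis by (simp add: green_def)
qed

lemma green_superharmonic: "green w n x - avg (green w n) x \<le> indicator {w} x"
proof -
  have "avg (green w n) x = (\<Sum>k<n. avg (heat k (indicator {w})) x)"
    unfolding green_def avg_def by (subst sum.swap) (simp add: sum_divide_distrib)
  also have "\<dots> = (\<Sum>k<n. heat (Suc k) (indicator {w}) x)" by (simp add: heat_Suc)
  finally have "green w n x - avg (green w n) x = - (\<Sum>k<n. heat (Suc k) (indicator {w}) x - heat k (indicator {w}) x)"
    by (simp add: green_def sum_subtractf)
  also have "\<dots> = indicator {w} x - heat n (indicator {w}) x"
    by (subst sum_lessThan_telescope) simp
  also have "\<dots> \<le> indicator {w} x" using heat_nonneg[of "indicator {w}" n x] by simp
  finally show ?thesis .
qed

text \<open>
  The Faber--Krahn inequality for the truncation of the Green function to a band of levels. The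
  bound does not depend on \<open>n\<close>. The escape time grows linearly in \<open>k\<close>, that is, logarithmically in the
  size of the set.
\<close>

lemma green_bounded:
  fixes c :: real and M :: nat
  assumes c: "c > 0" and w: "w \<in> V"
    and esc: "\<And>A k x. finite A \<Longrightarrow> card A \<le> 2 ^ Suc k \<Longrightarrow> x \<in> V \<Longrightarrow>
        c \<le> heat (M * (k + 2)) (indicator (- A)) x"
  shows "green w n w \<le> 44 * d * M\<^sup>2 / c"
proof -
  define u where "u = green w n"
  define \<beta> where "\<beta> = 2 * d * M\<^sup>2 / c"
  have "\<exists>K. u w \<le> (\<Sum>k<K. \<beta> * ((real k + 2)\<^sup>2 / 2 ^ k))"
  proof (rule level_set_chain[where u = u])
    fix s t :: real and k :: nat
    assume st: "0 \<le> s" "s < t" and sm: "card {x. s < u x} \<le> 2 ^ Suc k"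
      and lg: "2 ^ k \<le> card {x. t \<le> u x}"
    define A where "A = {x. s < u x}"
    define f where "f x = min (max (u x - s) 0) (t - s)" for x
    have A: "finite A" "A \<subseteq> V"
    proof -
      show "finite A" unfolding A_def
        by (rule finite_subset[OF _ finite_support_green[of w n]]) (use st in \<open>auto simp: u_def\<close>)
      show "A \<subseteq> V" using green_outside[OF _ w, of _ n] st by (force simp: A_def u_def)
    qed
    have "c * (\<Sum>x\<in>A. (f x)\<^sup>2) \<le> (real (M * (k + 2)))\<^sup>2 * (2 * d * (t - s))"
    proof (rule faber_krahn[OF _ A])
      show "(\<Sum>x\<in>S. \<Sum>y\<in>N x. (f x - f y)\<^sup>2) \<le> 2 * d * (t - s)" if "finite S" for S
        using finite_support_green green_superharmonic st that
        unfolding u_def by (intro truncation_energy[of "green w n" w s t S f]) (auto simp: f_def u_def)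
      show "f x = 0" if "x \<notin> A" for x using that st by (auto simp: A_def f_def)
      show "c \<le> heat (M * (k + 2)) (indicator (- A)) x" if "x \<in> A" for x
        using esc[of A k x] A sm that by (auto simp: A_def)
    qed
    moreover have "2 ^ k * (t - s)\<^sup>2 \<le> (\<Sum>x\<in>A. (f x)\<^sup>2)"
    proof -
      have "2 ^ k * (t - s)\<^sup>2 \<le> real (card {x. t \<le> u x}) * (t - s)\<^sup>2"
        using lg by (intro mult_right_mono) (simp_all flip: of_nat_power_eq_of_nat_cancel_iff add: numeral_power_le_of_nat_cancel_iff)
      also have "\<dots> = (\<Sum>x\<in>{x. t \<le> u x}. (f x)\<^sup>2)"
        using st by (simp add: f_def)
      also have "\<dots> \<le> (\<Sum>x\<in>A. (f x)\<^sup>2)"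
        using A st by (intro sum_mono2) (auto simp: A_def)
      finally show ?thesis .
    qed
    ultimately have "c * (2 ^ k * (t - s)\<^sup>2) \<le> (real (M * (k + 2)))\<^sup>2 * (2 * d * (t - s))"
      using c by (smt (verit) mult_left_mono)
    then have "(t - s) * (c * 2 ^ k * (t - s)) \<le> (t - s) * ((real (M * (k + 2)))\<^sup>2 * (2 * d))"
      by (simp add: power2_eq_square algebra_simps)
    then have "c * 2 ^ k * (t - s) \<le> (real (M * (k + 2)))\<^sup>2 * (2 * d)"
      using st by (simp only: mult_le_cancel_left_pos[of "t - s"] diff_gt_0_iff_gt)
    then show "t - s \<le> \<beta> * ((real k + 2)\<^sup>2 / 2 ^ k)"
      using c by (simp add: \<beta>_def field_simps power2_eq_square)
  qed (auto simp: u_def finite_support_green green_nonneg \<beta>_def c less_imp_le)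
  then obtain K where "u w \<le> \<beta> * (\<Sum>k<K. (real k + 2)\<^sup>2 / 2 ^ k)"
    by (auto simp: sum_distrib_left)
  also have "\<dots> \<le> \<beta> * 22"
    using c by (intro mult_left_mono sum_quadratic_over_power2) (simp add: \<beta>_def)
  finally show ?thesis by (simp add: u_def \<beta>_def)
qed

section \<open>Marginals of the walk\<close>

lemma pmf_step: "x \<in> V \<Longrightarrow> pmf (pmf_of_set (N x)) y = indicator (N x) y / card (N x)"
  by (simp add: nbrs_nonempty)

lemma measurable_srw_coord [measurable]:
  "(\<lambda>\<omega>. \<omega> n) \<in> srw G x0 \<rightarrow>\<^sub>M count_space UNIV"
  by (subst measurable_cong_sets[OF sets_srw refl]) (rule measurable_component_singleton, simp)

text \<open>
  The Markov property at time \<open>m\<close>, with the past fixed completely. Induction on the remaining time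
  \<open>n\<close> needs all \<open>m\<close>: the path is extended by one vertex, and almost surely this is one of the finitely many
  neighbours of \<open>f m\<close>.
\<close>

lemma prob_srw_path_then:
  assumes "f 0 = x0" "\<And>i. f i \<in> V"
  shows "\<P>(\<omega> in srw G x0. (\<forall>i\<le>m. \<omega> i = f i) \<and> \<omega> (m + n) = y)
     = (\<Prod>i<m. pmf (pmf_of_set (N (f i))) (f (Suc i))) * heat n (indicator {y}) (f m)"
  using assms
proof (induction n arbitrary: m f)
  case 0
  have "{\<omega> \<in> space (srw G x0). (\<forall>i\<le>m. \<omega> i = f i) \<and> \<omega> (m + 0) = y}
      = (if f m = y then {\<omega> \<in> space (srw G x0). \<forall>i\<le>m. \<omega> i = f i} else {})"
    by auto
  then show ?case using prob_srw_path[of G x0 m f] 0 by (auto simp: indicator_def)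
next
  case (Suc n)
  interpret prob_space "srw G x0" by (rule prob_space_srw)
  let ?S = "space (srw G x0)"
  let ?\<pi> = "\<Prod>i<m. pmf (pmf_of_set (N (f i))) (f (Suc i))"
  define B where "B = {\<omega> \<in> ?S. \<forall>i\<le>m. \<omega> i = f i}"
  define g where "g z = f(Suc m := z)" for z
  define D where "D z = {\<omega> \<in> ?S. \<forall>i\<le>Suc m. \<omega> i = g z i}" for z
  define Y where "Y = {\<omega> \<in> ?S. \<omega> (m + Suc n) = y}"
  have V: "f m \<in> V" using Suc by simp
  have meas: "B \<in> events" "\<And>z. D z \<in> events" "Y \<in> events"
    unfolding B_def D_def Y_def by measurable
  have gpi: "(\<Prod>i<Suc m. pmf (pmf_of_set (N (g z i))) (g z (Suc i))) = ?\<pi> * (1 / card (N (f m)))"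
    if "z \<in> N (f m)" for z
  proof -
    have "(\<Prod>i<m. pmf (pmf_of_set (N (g z i))) (g z (Suc i))) = ?\<pi>"
      by (intro prod.cong) (auto simp: g_def)
    then show ?thesis using that V by (simp add: g_def pmf_step)
  qed
  have disj: "disjoint_family_on D (N (f m))"
    by (auto simp: disjoint_family_on_def D_def g_def)
  have sub: "(\<Union>z\<in>N (f m). D z) \<subseteq> B"
    by (auto simp: B_def D_def g_def)
  have "prob (\<Union>z\<in>N (f m). D z) = (\<Sum>z\<in>N (f m). prob (D z))"
    using meas by (intro finite_measure_finite_Union disj) auto
  also have "\<dots> = (\<Sum>z\<in>N (f m). ?\<pi> * (1 / card (N (f m))))"
  proof (rule sum.cong[OF refl])
    fix z assume z: "z \<in> N (f m)"
    show "prob (D z) = ?\<pi> * (1 / card (N (f m)))"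
      unfolding D_def prob_srw_path gpi[OF z, symmetric] using Suc.prems by (simp add: g_def)
  qed
  also have "\<dots> = ?\<pi>" using nbrs_nonempty[OF V] by simp
  also have "?\<pi> = prob B" unfolding B_def prob_srw_path using Suc.prems by simp
  finally have eq: "prob (\<Union>z\<in>N (f m). D z) = prob B" .
  have null: "prob (B - (\<Union>z\<in>N (f m). D z)) = 0"
    using finite_measure_Diff[OF meas(1) _ sub] meas eq by (simp add: sets.finite_UN)
  have "prob (B \<inter> Y) = prob (\<Union>z\<in>N (f m). D z \<inter> Y)"
  proof (rule antisym)
    have "prob (B \<inter> Y) \<le> prob ((\<Union>z\<in>N (f m). D z \<inter> Y) \<union> (B - (\<Union>z\<in>N (f m). D z)))"
      using meas by (intro finite_measure_mono sets.Un sets.Diff sets.finite_UN) auto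
    also have "\<dots> \<le> prob (\<Union>z\<in>N (f m). D z \<inter> Y) + prob (B - (\<Union>z\<in>N (f m). D z))"
      using meas by (intro measure_Un_le sets.Diff sets.finite_UN) auto
    finally show "prob (B \<inter> Y) \<le> prob (\<Union>z\<in>N (f m). D z \<inter> Y)" using null by simp
    show "prob (\<Union>z\<in>N (f m). D z \<inter> Y) \<le> prob (B \<inter> Y)"
      using meas sub by (intro finite_measure_mono) auto
  qed
  also have "\<dots> = (\<Sum>z\<in>N (f m). prob (D z \<inter> Y))"
    using meas disj by (intro finite_measure_finite_Union) (auto simp: disjoint_family_on_def)
  also have "\<dots> = (\<Sum>z\<in>N (f m). ?\<pi> * (1 / card (N (f m))) * heat n (indicator {y}) z)"
  proof (rule sum.cong[OF refl])
    fix z assume z: "z \<in> N (f m)"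
    have "D z \<inter> Y = {\<omega> \<in> ?S. (\<forall>i\<le>Suc m. \<omega> i = g z i) \<and> \<omega> (Suc m + n) = y}"
      by (auto simp: D_def Y_def)
    moreover have "g z i \<in> V" for i using z Suc.prems nbrs_subset by (auto simp: g_def)
    ultimately show "prob (D z \<inter> Y) = ?\<pi> * (1 / card (N (f m))) * heat n (indicator {y}) z"
      using Suc.IH[of "g z" "Suc m"] Suc.prems gpi[OF z] by (simp add: g_def)
  qed
  also have "\<dots> = ?\<pi> * heat (Suc n) (indicator {y}) (f m)"
    by (simp add: heat_Suc avg_def sum_distrib_left sum_divide_distrib)
  finally show ?case by (simp add: B_def Y_def Int_def conj_ac cong: conj_cong)
qed

lemma prob_srw_coord:
  assumes "x0 \<in> V"
  shows "\<P>(\<omega> in srw G x0. \<omega> n = y) = heat n (indicator {y}) x0"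
proof -
  interpret prob_space "srw G x0" by (rule prob_space_srw)
  have "\<P>(\<omega> in srw G x0. \<omega> 0 = x0) = 1"
    using prob_srw_path[of G x0 0 "\<lambda>_. x0"] by simp
  then have "AE \<omega> in srw G x0. \<omega> 0 = x0"
    by (subst (asm) prob_Collect_eq_1) measurable
  then have "\<P>(\<omega> in srw G x0. \<omega> n = y) = \<P>(\<omega> in srw G x0. (\<forall>i\<le>0. \<omega> i = x0) \<and> \<omega> (0 + n) = y)"
    by (intro finite_measure_eq_AE) auto
  also have "\<dots> = heat n (indicator {y}) x0"
    using prob_srw_path_then[of "\<lambda>_. x0" x0 0 n y] assms by simp
  finally show ?thesis .
qed

lemma srw_entropy_eq:
  assumes "x0 \<in> V"
  shows "srw_entropy G x0 n =
    - (\<Sum>y\<in>reach n x0. heat n (indicator {y}) x0 * ln (heat n (indicator {y}) x0))"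
proof -
  have "(\<Sum>\<^sub>\<infinity>y\<in>V. heat n (indicator {y}) x0 * ln (heat n (indicator {y}) x0))
     = (\<Sum>\<^sub>\<infinity>y\<in>reach n x0. heat n (indicator {y}) x0 * ln (heat n (indicator {y}) x0))"
    using reach_subset[OF assms, of n] by (intro infsum_cong_neutral) (auto simp: heat_outside_reach)
  then show ?thesis unfolding srw_entropy_def by (simp add: prob_srw_coord[OF assms])
qed

section \<open>Transience\<close>

lemma transient_if_linear_entropy:
  fixes C :: real
  assumes C: "C > 0" and ent: "\<And>x n. x \<in> V \<Longrightarrow> n \<ge> 1 \<Longrightarrow> srw_entropy G x n \<ge> C * real n"
  shows "srw_transient G"
  unfolding srw_transient_def
proof
  fix w assume w: "w \<in> V"
  interpret prob_space "srw G w" by (rule prob_space_srw)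
  \<comment> \<open>At time \<open>n = M (k + 2)\<close> the term \<open>ln (2 \<cdot> 2\<^sup>k\<^sup>+\<^sup>1)\<close> of the entropy bound uses up at most half of
    \<open>C n\<close>; the escape term has to supply the other half, which determines \<open>c\<close>.\<close>
  define M where "M = nat \<lceil>2 / C\<rceil>"
  have CM: "2 \<le> C * M"
  proof -
    have "2 / C \<le> M" unfolding M_def by linarith
    then show ?thesis using C by (simp add: field_simps)
  qed
  then have M: "M > 0" by (intro gr0I) auto
  define L where "L = ln (real d + 1)"
  have "d > 0" using card_N_pos[OF w] card_N[of w] by linarith
  then have l: "L > 0" by (simp add: L_def)
  define c where "c = C / (2 * L)"
  have c: "c > 0" using C l by (simp add: c_def)
  have esc: "c \<le> heat (M * (k + 2)) (indicator (- A)) x"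
    if A: "finite A" "card A \<le> 2 ^ Suc k" and x: "x \<in> V" for A k x
  proof -
    define n where "n = M * (k + 2)"
    define h where "h = heat n (indicator (- A)) x"
    have n: "n \<ge> 1" using M by (simp add: n_def)
    have "C * n \<le> srw_entropy G x n" by (rule ent[OF x n])
    also have "\<dots> \<le> ln (2 * 2 ^ Suc k) + n * L * h"
      unfolding srw_entropy_eq[OF x] L_def h_def
    proof (rule entropy_le_of_escape[OF x A(1)])
      show "real (card A) \<le> 2 ^ Suc k"
        using A(2) by (metis of_nat_le_iff of_nat_numeral of_nat_power)
      show "(1 :: real) \<le> 2 ^ Suc k" by (rule one_le_power) simp
    qed
    also have "ln (2 * 2 ^ Suc k :: real) = (k + 2) * ln 2"
      using ln_realpow[of "2::real" "k + 2"] by (simp add: algebra_simps)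
    also have "\<dots> \<le> k + 2" using ln_2_less_1 by (simp add: mult_le_cancel_left2)
    also have "real (k + 2) \<le> C * n / 2"
      using mult_right_mono[OF CM, of "real (k + 2)"] by (simp add: n_def algebra_simps)
    finally have "C / 2 * n \<le> L * h * n" by (simp add: algebra_simps)
    then have "C / 2 \<le> L * h" using n by (simp add: mult_le_cancel_right)
    then show ?thesis using l by (simp add: c_def h_def n_def field_simps)
  qed
  have bound: "(\<Sum>k<n. prob {\<omega> \<in> space (srw G w). \<omega> k = w}) \<le> 44 * d * M\<^sup>2 / c" for n
    using green_bounded[OF c w esc, of n] by (simp add: green_def prob_srw_coord[OF w])
  have "summable (\<lambda>k. prob {\<omega> \<in> space (srw G w). \<omega> k = w})"
    by (rule summableI_nonneg_bounded[OF _ bound]) simp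
  then have "AE \<omega> in srw G w. eventually (\<lambda>k. \<omega> \<in> space (srw G w) - {\<omega> \<in> space (srw G w). \<omega> k = w}) sequentially"
    by (intro borel_cantelli_AE1) (auto simp: emeasure_eq_measure less_top[symmetric])
  then show "AE \<omega> in srw G w. finite {n. \<omega> n = w}"
  proof (eventually_elim)
    case (elim \<omega>)
    then show ?case
      by (simp add: space_srw eventually_cofinite flip: cofinite_eq_sequentially)
  qed
qed

end

lemma nbrs_nonempty_if_connected_infinite:
  assumes "pair_bidirected_digraph G" "Digraph_Component.connected (with_proj G)"
    "infinite (pverts G)" "x \<in> pverts G"
  shows "nbrs G x \<noteq> {}"
proof
  assume e: "nbrs G x = {}"
  interpret pair_bidirected_digraph G by fact
  obtain y where y: "y \<in> pverts G" "y \<noteq> x"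
    using assms(3) by (metis finite.emptyI finite_insert finite_subset insertI1 subsetI)
  have "x \<rightarrow>\<^sup>*\<^bsub>mk_symmetric (with_proj G)\<^esub> y"
    using assms(2,4) y by (auto simp: Digraph_Component.connected_def strongly_connected_def)
  then have "\<exists>z. (x, z) \<in> parcs (mk_symmetric (with_proj G))"
    using y(2) unfolding reachable_def by (cases rule: converse_rtrancl_on_cases) auto
  then obtain z where "(x, z) \<in> parcs G \<or> (z, x) \<in> parcs G"
    by (simp add: parcs_mk_symmetric) (metis prod.collapse prod.inject)
  then show False using e arcs_symmetric by (auto simp: nbrs_def)
qed

theorem theorem1:
  fixes G :: "'a pair_pre_digraph" and d :: nat and C :: real
  assumes "pair_bidirected_digraph G"
    and "Digraph_Component.connected (with_proj G)"
    and "infinite (pverts G)"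
    and "has_max_degree G d"
    and "C > 0"
    and "\<And>x0 n. x0 \<in> pverts G \<Longrightarrow> n \<ge> 1 \<Longrightarrow> srw_entropy G x0 n \<ge> C * real n"
  shows "srw_transient G"
proof -
  interpret pair_bidirected_digraph G by fact
  interpret bounded_degree_graph G d
    using assms(4) nbrs_nonempty_if_connected_infinite[OF assms(1-3)]
    by unfold_locales (auto simp: has_max_degree_def)
  show ?thesis by (rule transient_if_linear_entropy[OF assms(5,6)])
qed

end
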